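(* Let $p$ be a constant and let $q:\mathbb{R}^2_+\to\mathbb{R}$ be a measurable function such that $1<p\le q_-\le q_+<\infty$, and let $v$ be an a.e. positive measurable function on $\mathbb{R}^2_+$. Then $\mathcal{H}_2$ is bounded from $L^p(\mathbb{R}^2_+)$ to $L^{q(\cdot)}_v(\mathbb{R}^2_+)$ if and only if $$\sup_{a,b>0}\big\|v\,\chi_{J^\infty_{ab}}\big\|_{L^{q(\cdot)}(\mathbb{R}^2_+)}\,(ab)^{\frac1{p'}}<\infty,$$ where $J^\infty_{ab}=[a,\infty)\times[b,\infty)$.
   Context: $\mathbb{R}^2_+=[0,\infty)^2$, $p'=p/(p-1)$, $q_-=\inf_{\mathbb{R}^2_+}q$, $q_+=\sup_{\mathbb{R}^2_+}q$; $\chi_E$ is the indicator of $E$. The norm of $L^{q(\cdot)}(\mathbb{R}^2_+)$ is $\|f\|_{L^{q(\cdot)}}=\inf\{\lambda>0:\int|f(x)/\lambda|^{q(x)}dx\le1\}$, and $\|f\|_{L^{q(\cdot)}_v}=\|fv\|_{L^{q(\cdot)}}$. The double Hardy transform is $(\mathcal{H}_2f)(x,y)=\int_0^x\int_0^y f(t,\tau)\,dt\,d\tau$. Bounded means that there is $c>0$ with $\|\mathcal{H}_2f\|_{L^{q(\cdot)}_v}\le c\|f\|_{L^p}$ for all $f\in L^p(\mathbb{R}^2_+)$. *)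

theory Defs
  imports "HOL-Analysis.Analysis"
begin

definition quadrant :: "(real \<times> real) set" where
  "quadrant = {0..} \<times> {0..}"

text \<open>Functions on the quadrant are total functions on the plane whose values outside
  the quadrant are irrelevant; measurable means Lebesgue measurable.\<close>

abbreviation quadrant_measure :: "(real \<times> real) measure" where
  "quadrant_measure \<equiv> lebesgue_on quadrant"

definition q_minus :: "(real \<times> real \<Rightarrow> real) \<Rightarrow> ereal" where
  "q_minus q = (INF z\<in>quadrant. ereal (q z))"

definition q_plus :: "(real \<times> real \<Rightarrow> real) \<Rightarrow> ereal" where
  "q_plus q = (SUP z\<in>quadrant. ereal (q z))"

definition conj_exp :: "real \<Rightarrow> real" where
  "conj_exp p = p / (p - 1)"

text \<open>The infimum is taken in \<^typ>\<open>ennreal\<close>, so that the norm is infinite when no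
  \<open>l\<close> is admissible.\<close>

definition var_norm :: "(real \<times> real \<Rightarrow> real) \<Rightarrow> (real \<times> real \<Rightarrow> real) \<Rightarrow> ennreal" where
  "var_norm q f =
     Inf {ennreal l | l. l > 0 \<and>
       (\<integral>\<^sup>+ z. ennreal (\<bar>f z / l\<bar> powr q z) \<partial>quadrant_measure) \<le> 1}"

definition weighted_var_norm ::
    "(real \<times> real \<Rightarrow> real) \<Rightarrow> (real \<times> real \<Rightarrow> real) \<Rightarrow> (real \<times> real \<Rightarrow> real) \<Rightarrow> ennreal" where
  "weighted_var_norm q v f = var_norm q (\<lambda>z. f z * v z)"

definition Lp_space :: "real \<Rightarrow> (real \<times> real \<Rightarrow> real) set" where
  "Lp_space p = {f. f \<in> borel_measurable quadrant_measure \<and>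
     integrable quadrant_measure (\<lambda>z. \<bar>f z\<bar> powr p)}"

definition Lp_norm :: "real \<Rightarrow> (real \<times> real \<Rightarrow> real) \<Rightarrow> real" where
  "Lp_norm p f = (LINT z|quadrant_measure. \<bar>f z\<bar> powr p) powr (1 / p)"

text \<open>The variable \<open>t\<close> runs over \<open>[0, x]\<close> and \<open>s\<close> over \<open>[0, y]\<close>. The integrals are taken
  with respect to \<^const>\<open>lebesgue\<close> because sections of a Lebesgue measurable function
  need not be Borel measurable.\<close>

definition hardy2 :: "(real \<times> real \<Rightarrow> real) \<Rightarrow> real \<times> real \<Rightarrow> real" where
  "hardy2 f = (\<lambda>(x, y). LINT t:{0..x}|lebesgue. (LINT s:{0..y}|lebesgue. f (t, s)))"

definition hardy2_bounded ::
    "real \<Rightarrow> (real \<times> real \<Rightarrow> real) \<Rightarrow> (real \<times> real \<Rightarrow> real) \<Rightarrow> bool" where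
  "hardy2_bounded p q v \<longleftrightarrow>
     (\<exists>c>0. \<forall>f\<in>Lp_space p. weighted_var_norm q v (hardy2 f) \<le> ennreal (c * Lp_norm p f))"

definition J_inf :: "real \<Rightarrow> real \<Rightarrow> (real \<times> real) set" where
  "J_inf a b = {a..} \<times> {b..}"

end

theory Submission
  imports Defs
begin

text \<open>
  Write \<open>p'\<close> for the conjugate exponent and \<open>H\<close> for the double Hardy transform.
  Necessity comes from testing on the indicator of \<open>[0,a] \<times> [0,b]\<close>, whose transform
  is the constant \<open>a b\<close> on \<open>J\<^sub>a\<^sub>b\<close> (\<open>test_if_hardy2_bounded\<close>).

  For sufficiency, put \<open>\<gamma> = 1 / (2 p')\<close> and take \<open>\<parallel>f\<parallel>\<^sub>p \<le> 1\<close>. The point is that one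
  pointwise inequality linearises the problem: for every \<open>r \<ge> p\<close>,
  \<open>\<bar>H f (x,y)\<bar> powr r\<close> is at most the integral of
  \<open>\<bar>f(t,s)\<bar> powr p * (16 t s x y) powr (\<gamma> r)\<close> over \<open>0 < t \<le> x\<close>,
  \<open>0 < s \<le> y\<close> (\<open>hardy2_modular_pointwise\<close>). It is Hoelder's inequality with the three
  exponents \<open>r\<close>, \<open>1 / (1/p - 1/r)\<close>, \<open>p'\<close>; the middle factor is a power of
  \<open>\<bar>f\<bar> powr p\<close> and is absorbed by \<open>\<parallel>f\<parallel>\<^sub>p \<le> 1\<close>. As \<open>r\<close> only enters after \<open>(x,y)\<close> has been
  fixed, one may take \<open>r = q(x,y)\<close>.

  Multiplying by \<open>(v / D) powr q\<close>, integrating over \<open>(x,y)\<close> and exchanging the integrals,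
  it remains to bound the integral of \<open>((16 t s x y) powr \<gamma> * v / D) powr q\<close> over
  \<open>J\<^sub>t\<^sub>s\<close> by \<open>1\<close> for each \<open>(t,s)\<close>. Cut \<open>J\<^sub>t\<^sub>s\<close> dyadically. On the piece with corner
  \<open>(a,b) = (2\<^sup>i t, 2\<^sup>j s)\<close> the factor \<open>(t s x y) powr \<gamma>\<close> is at most a constant times
  \<open>2 powr (- (i + j) \<gamma>) * (a b) powr (1/p')\<close>, so that the condition on \<open>v\<close> at
  \<open>(a,b)\<close> applies and the gain sums to a geometric series
  (\<open>modular_on_J_inf_le_1\<close>).
\<close>

section \<open>Hoelder's inequality for three factors\<close>

lemma weighted_am_gm3:
  fixes a b c x y z :: real
  assumes "0 \<le> a" "0 \<le> b" "0 \<le> c" "a + b + c = 1"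
    and "0 \<le> x" "0 \<le> y" "0 \<le> z"
  shows "x powr a * y powr b * z powr c \<le> a * x + b * y + c * z"
proof (cases "x = 0 \<or> y = 0 \<or> z = 0")
  case True
  then show ?thesis using assms by auto
next
  case False
  then have pos: "0 < x" "0 < y" "0 < z" using assms by auto
  define G where "G = x powr a * y powr b * z powr c"
  have G: "0 < G" unfolding G_def using pos by simp
  \<comment> \<open>Concavity of the logarithm at the geometric mean \<open>G\<close>, as a tangent line; the
    weighted sum of the three left-hand sides below is zero.\<close>
  have tangent: "k * (ln u - ln G) \<le> k * (u / G - 1)" if "0 < u" "0 \<le> k" for u k
    using ln_le_minus_one[of "u / G"] that G by (intro mult_left_mono) (auto simp: ln_div)
  have "ln G = a * ln x + b * ln y + c * ln z"
    unfolding G_def using pos by (simp add: ln_mult)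
  moreover have "(a + b + c) * ln G = ln G" "a / G * x = a * (x / G)"
    using assms by auto
  ultimately have "0 \<le> a * (x / G - 1) + b * (y / G - 1) + c * (z / G - 1)"
    using tangent[of x a] tangent[of y b] tangent[of z c] pos assms
    by (simp add: algebra_simps)
  also have "\<dots> = (a * x + b * y + c * z) / G - (a + b + c)"
    by (simp add: algebra_simps add_divide_distrib)
  also have "\<dots> = (a * x + b * y + c * z) / G - 1" using assms by simp
  finally show ?thesis using G unfolding G_def[symmetric]
    by (simp add: le_divide_eq)
qed

text \<open>Normalise each factor to have integral at most one and integrate the weighted
  arithmetic-geometric mean inequality. Bounds \<open>X\<close>, \<open>Y\<close>, \<open>Z\<close> take the place of
  the integrals themselves, so that a factor may have integral zero.\<close>

lemma nn_integral_Holder3: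
  fixes F G H :: "'a \<Rightarrow> real" and a b c X Y Z :: real
  assumes [measurable]: "F \<in> borel_measurable M" "G \<in> borel_measurable M" "H \<in> borel_measurable M"
    and nonneg: "\<And>w. 0 \<le> F w" "\<And>w. 0 \<le> G w" "\<And>w. 0 \<le> H w"
    and abc: "0 \<le> a" "0 \<le> b" "0 \<le> c" "a + b + c = 1"
    and pos: "0 < X" "0 < Y" "0 < Z"
    and F: "(\<integral>\<^sup>+ w. ennreal (F w) \<partial>M) \<le> ennreal X"
    and G: "(\<integral>\<^sup>+ w. ennreal (G w) \<partial>M) \<le> ennreal Y"
    and H: "(\<integral>\<^sup>+ w. ennreal (H w) \<partial>M) \<le> ennreal Z"
  shows "(\<integral>\<^sup>+ w. ennreal (F w powr a * G w powr b * H w powr c) \<partial>M)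
     \<le> ennreal (X powr a * Y powr b * Z powr c)"
proof -
  define N where "N = X powr a * Y powr b * Z powr c"
  have N: "0 < N" unfolding N_def using pos by simp
  have scaled: "(\<integral>\<^sup>+ w. ennreal (k * N / U) * ennreal (u w) \<partial>M) \<le> ennreal (k * N)"
    if [measurable]: "u \<in> borel_measurable M" and "0 \<le> k" "0 < U"
      and "(\<integral>\<^sup>+ w. ennreal (u w) \<partial>M) \<le> ennreal U" for u :: "'a \<Rightarrow> real" and k U
  proof -
    have "(\<integral>\<^sup>+ w. ennreal (k * N / U) * ennreal (u w) \<partial>M)
        = ennreal (k * N / U) * (\<integral>\<^sup>+ w. ennreal (u w) \<partial>M)"
      by (simp add: nn_integral_cmult)
    also have "\<dots> \<le> ennreal (k * N / U) * ennreal U"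
      using that by (intro mult_left_mono) auto
    also have "\<dots> = ennreal (k * N)"
      using that N by (simp flip: ennreal_mult)
    finally show ?thesis .
  qed
  have pointwise: "F w powr a * G w powr b * H w powr c
     \<le> (a * N / X) * F w + (b * N / Y) * G w + (c * N / Z) * H w" for w
  proof -
    have "F w powr a * G w powr b * H w powr c
        = N * ((F w / X) powr a * (G w / Y) powr b * (H w / Z) powr c)"
      unfolding N_def using pos nonneg by (simp add: powr_divide)
    also have "\<dots> \<le> N * (a * (F w / X) + b * (G w / Y) + c * (H w / Z))"
      using N nonneg pos abc by (intro mult_left_mono weighted_am_gm3) auto
    finally show ?thesis by (simp add: algebra_simps)
  qed
  have "(\<integral>\<^sup>+ w. ennreal (F w powr a * G w powr b * H w powr c) \<partial>M)
     \<le> (\<integral>\<^sup>+ w. ennreal (a * N / X) * ennreal (F w) + ennreal (b * N / Y) * ennreal (G w)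
           + ennreal (c * N / Z) * ennreal (H w) \<partial>M)"
  proof (rule nn_integral_mono)
    fix w
    show "ennreal (F w powr a * G w powr b * H w powr c)
      \<le> ennreal (a * N / X) * ennreal (F w) + ennreal (b * N / Y) * ennreal (G w)
           + ennreal (c * N / Z) * ennreal (H w)"
      using pointwise[of w] nonneg[of w] abc pos N
      by (simp flip: ennreal_mult ennreal_plus)
  qed
  also have "\<dots> = (\<integral>\<^sup>+ w. ennreal (a * N / X) * ennreal (F w) \<partial>M)
     + (\<integral>\<^sup>+ w. ennreal (b * N / Y) * ennreal (G w) \<partial>M)
     + (\<integral>\<^sup>+ w. ennreal (c * N / Z) * ennreal (H w) \<partial>M)"
    by (simp add: nn_integral_add)
  also have "\<dots> \<le> ennreal (a * N) + ennreal (b * N) + ennreal (c * N)"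
    using abc pos F G H by (intro add_mono scaled) auto
  also have "\<dots> = ennreal ((a + b + c) * N)"
    using abc(1-3) N by (simp add: distrib_right flip: ennreal_plus)
  finally show ?thesis using abc by (simp add: N_def)
qed

section \<open>The variable exponent norm\<close>

lemma var_norm_le:
  assumes "0 < l" "(\<integral>\<^sup>+ z. ennreal (\<bar>f z / l\<bar> powr q z) \<partial>quadrant_measure) \<le> 1"
  shows "var_norm q f \<le> ennreal l"
  unfolding var_norm_def using assms by (intro Inf_lower) auto

lemma var_norm_cmult_ge:
  assumes "0 < k"
  shows "ennreal k * var_norm q f \<le> var_norm q (\<lambda>z. k * f z)"
  unfolding var_norm_def[of q "\<lambda>z. k * f z"]
proof (rule Inf_greatest, clarify)
  fix l :: real
  assume l: "0 < l" "(\<integral>\<^sup>+ z. ennreal (\<bar>k * f z / l\<bar> powr q z) \<partial>quadrant_measure) \<le> 1"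
  have "k * f z / l = f z / (l / k)" for z using assms by simp
  with l(2) have "(\<integral>\<^sup>+ z. ennreal (\<bar>f z / (l / k)\<bar> powr q z) \<partial>quadrant_measure) \<le> 1"
    by (simp only:)
  then have "var_norm q f \<le> ennreal (l / k)"
    using l assms by (intro var_norm_le) simp_all
  then have "ennreal k * var_norm q f \<le> ennreal k * ennreal (l / k)"
    by (rule mult_left_mono) simp
  also have "\<dots> = ennreal l" using assms l by (simp flip: ennreal_mult)
  finally show "ennreal k * var_norm q f \<le> ennreal l" .
qed

lemma var_norm_mono:
  assumes "\<And>z. z \<in> quadrant \<Longrightarrow> \<bar>f z\<bar> \<le> \<bar>g z\<bar>" "\<And>z. z \<in> quadrant \<Longrightarrow> 0 \<le> q z"
  shows "var_norm q f \<le> var_norm q g"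
  unfolding var_norm_def
proof (rule Inf_superset_mono, clarify)
  fix l :: real
  assume l: "0 < l" "(\<integral>\<^sup>+ z. ennreal (\<bar>g z / l\<bar> powr q z) \<partial>quadrant_measure) \<le> 1"
  have "(\<integral>\<^sup>+ z. ennreal (\<bar>f z / l\<bar> powr q z) \<partial>quadrant_measure)
     \<le> (\<integral>\<^sup>+ z. ennreal (\<bar>g z / l\<bar> powr q z) \<partial>quadrant_measure)"
    using assms l
    by (intro nn_integral_mono ennreal_leI powr_mono2)
       (auto simp: abs_divide intro!: divide_right_mono)
  then show "\<exists>la. ennreal l = ennreal la \<and> 0 < la \<and>
      (\<integral>\<^sup>+ z. ennreal (\<bar>f z / la\<bar> powr q z) \<partial>quadrant_measure) \<le> 1"
    using l by (intro exI[of _ l]) auto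
qed

text \<open>The infimum need not be attained a priori, but any \<open>l\<close> above it dominates an
  admissible value, and the modular decreases in \<open>l\<close>.\<close>

lemma modular_le_1_if_var_norm_less:
  assumes "var_norm q f < ennreal l" "\<And>z. z \<in> quadrant \<Longrightarrow> 0 \<le> q z"
  shows "(\<integral>\<^sup>+ z. ennreal (\<bar>f z / l\<bar> powr q z) \<partial>quadrant_measure) \<le> 1"
proof -
  obtain m where m: "0 < m" "ennreal m < ennreal l"
      "(\<integral>\<^sup>+ z. ennreal (\<bar>f z / m\<bar> powr q z) \<partial>quadrant_measure) \<le> 1"
    using assms(1) unfolding var_norm_def Inf_less_iff by auto
  have ml: "m < l" using m by (simp add: ennreal_less_iff)
  have "(\<integral>\<^sup>+ z. ennreal (\<bar>f z / l\<bar> powr q z) \<partial>quadrant_measure)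
     \<le> (\<integral>\<^sup>+ z. ennreal (\<bar>f z / m\<bar> powr q z) \<partial>quadrant_measure)"
    using assms(2) m ml
    by (intro nn_integral_mono ennreal_leI powr_mono2)
       (auto simp: abs_divide intro!: divide_left_mono)
  with m show ?thesis by simp
qed

section \<open>Lebesgue measure on the quadrant\<close>

lemma sets_quadrant [measurable]: "quadrant \<in> sets borel"
  unfolding quadrant_def by (intro borel_closed closed_Times) auto

lemma sigma_finite_quadrant: "sigma_finite_measure quadrant_measure"
proof -
  have "sigma_finite_measure (lebesgue :: (real \<times> real) measure)"
  proof
    obtain A where "countable A" "A \<subseteq> sets lborel" "\<Union>A = space (lborel :: (real \<times> real) measure)"
        "\<forall>a\<in>A. emeasure lborel a \<noteq> \<infinity>"
      using lborel.sigma_finite_countable by blast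
    then show "\<exists>A. countable A \<and> A \<subseteq> sets (lebesgue :: (real \<times> real) measure) \<and>
        \<Union>A = space lebesgue \<and> (\<forall>a\<in>A. emeasure lebesgue a \<noteq> \<infinity>)"
      by (intro exI[of _ A]) (auto simp: subset_eq)
  qed
  then show ?thesis
    by (rule sigma_finite_measure_restrict_space) (simp add: sets_completionI_sets)
qed

lemma measurable_quadrant_borel:
  "f \<in> borel_measurable borel \<Longrightarrow> f \<in> borel_measurable quadrant_measure"
  by (intro measurable_restrict_space1 measurable_completion) simp

lemma measurable_indicator_J_inf [measurable]:
  "(indicator (J_inf a b) :: _ \<Rightarrow> ennreal) \<in> borel_measurable quadrant_measure"
  by (rule measurable_quadrant_borel)
    (auto simp: J_inf_def intro!: borel_measurable_indicator borel_closed closed_Times)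

definition area :: "real \<times> real \<Rightarrow> real" where
  "area z = fst z * snd z"

lemma borel_measurable_area [measurable]: "area \<in> borel_measurable borel"
  by (auto simp: area_def[abs_def] intro!: borel_measurable_continuous_onI continuous_intros)

lemma measurable_area [measurable]: "area \<in> borel_measurable quadrant_measure"
  by (rule measurable_quadrant_borel) simp

text \<open>The domain of integration of \<^const>\<open>hardy2\<close> at \<open>z\<close>, without the two sides on the
  axes, where negative powers of \<^const>\<open>area\<close> take the value \<open>0\<close> and the factorisation of
  \<open>\<bar>f\<bar>\<close> behind the Hoelder estimate would break down.\<close>
definition below :: "real \<times> real \<Rightarrow> (real \<times> real) set" where
  "below z = {0<..fst z} \<times> {0<..snd z}"

lemma sets_below [measurable]: "below z \<in> sets borel"
  unfolding below_def by (rule borel_Times) auto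

lemma below_subset_quadrant: "below z \<subseteq> quadrant"
  by (auto simp: below_def quadrant_def)

section \<open>A pointwise bound for the double Hardy transform\<close>

text \<open>A nonintegrable function has Bochner integral \<open>0\<close>, so the bound is unconditional.\<close>

lemma ennreal_abs_integral_le: "ennreal \<bar>integral\<^sup>L M f\<bar> \<le> (\<integral>\<^sup>+ x. ennreal \<bar>f x\<bar> \<partial>M)"
  for f :: "'a \<Rightarrow> real"
  using integral_norm_bound_ennreal[of M f] by (cases "integrable M f") (auto simp: not_integrable_integral_eq)

text \<open>The iterated integral is over sections of a Lebesgue measurable function, to which
  Tonelli's theorem does not apply directly. Replace \<open>f\<close> by a Borel function \<open>g\<close> equal to it
  almost everywhere: almost all sections then agree almost everywhere, and Tonelli's theorem
  holds for \<open>g\<close>.\<close>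

lemma hardy2_le_nn_integral:
  fixes f :: "real \<times> real \<Rightarrow> real"
  assumes f: "f \<in> borel_measurable quadrant_measure"
  shows "ennreal \<bar>hardy2 f z\<bar> \<le> (\<integral>\<^sup>+ w. ennreal \<bar>f w\<bar> * indicator (below z) w \<partial>quadrant_measure)"
proof -
  obtain x y where z: "z = (x, y)" by (cases z)
  have "(\<lambda>w. if w \<in> quadrant then f w else 0) \<in> borel_measurable lebesgue"
    using f by (subst measurable_restrict_space_iff[symmetric]) (auto simp: sets_completionI_sets)
  then obtain g where g [measurable]: "g \<in> borel_measurable lborel"
      and fg: "AE w in lborel. (if w \<in> quadrant then f w else 0) = g w"
    using completion_ex_borel_measurable_real by blast
  have g' [measurable]: "g \<in> borel_measurable (lborel \<Otimes>\<^sub>M lborel)"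
    using g by (simp add: lborel_prod)
  have "AE w in lborel \<Otimes>\<^sub>M lborel. (if w \<in> quadrant then f w else 0) = g w"
    using fg unfolding lborel_prod .
  from lborel_pair.AE_pair[OF this] have ae: "AE t in lborel. AE s in lborel. (if (t, s) \<in> quadrant then f (t, s) else 0) = g (t, s)"
    .
  have inner: "ennreal \<bar>indicator {0..x} t *\<^sub>R (LINT s:{0..y}|lebesgue. f (t, s))\<bar>
      \<le> (\<integral>\<^sup>+ s. ennreal \<bar>g (t, s)\<bar> * indicator (below z) (t, s) \<partial>lborel)"
    if ae_t: "AE s in lborel. (if (t, s) \<in> quadrant then f (t, s) else 0) = g (t, s)" and "t \<noteq> 0"
    for t
  proof (cases "t \<in> {0..x}")
    case True
    have "ennreal \<bar>LINT s:{0..y}|lebesgue. f (t, s)\<bar>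
        \<le> (\<integral>\<^sup>+ s. ennreal \<bar>indicator {0..y} s *\<^sub>R f (t, s)\<bar> \<partial>lebesgue)"
      unfolding set_lebesgue_integral_def by (rule ennreal_abs_integral_le)
    also have "\<dots> = (\<integral>\<^sup>+ s. ennreal \<bar>indicator {0..y} s *\<^sub>R f (t, s)\<bar> \<partial>lborel)"
      by (rule nn_integral_completion)
    also have "\<dots> \<le> (\<integral>\<^sup>+ s. ennreal \<bar>g (t, s)\<bar> * indicator (below z) (t, s) \<partial>lborel)"
    proof (rule nn_integral_mono_AE)
      show "AE s in lborel. ennreal \<bar>indicator {0..y} s *\<^sub>R f (t, s)\<bar>
          \<le> ennreal \<bar>g (t, s)\<bar> * indicator (below z) (t, s)"
        using ae_t AE_lborel_singleton[of 0]
        by eventually_elim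
          (use True \<open>t \<noteq> 0\<close> in \<open>auto simp: below_def quadrant_def z indicator_def split: if_splits\<close>)
    qed
    finally show ?thesis using True by simp
  qed auto
  have "ennreal \<bar>hardy2 f z\<bar>
      \<le> (\<integral>\<^sup>+ t. ennreal \<bar>indicator {0..x} t *\<^sub>R (LINT s:{0..y}|lebesgue. f (t, s))\<bar> \<partial>lebesgue)"
    unfolding hardy2_def z prod.case
    by (subst set_lebesgue_integral_def) (rule ennreal_abs_integral_le)
  also have "\<dots> = (\<integral>\<^sup>+ t. ennreal \<bar>indicator {0..x} t *\<^sub>R (LINT s:{0..y}|lebesgue. f (t, s))\<bar> \<partial>lborel)"
    by (rule nn_integral_completion)
  also have "\<dots> \<le> (\<integral>\<^sup>+ t. (\<integral>\<^sup>+ s. ennreal \<bar>g (t, s)\<bar> * indicator (below z) (t, s) \<partial>lborel) \<partial>lborel)"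
  proof (rule nn_integral_mono_AE)
    show "AE t in lborel. ennreal \<bar>indicator {0..x} t *\<^sub>R (LINT s:{0..y}|lebesgue. f (t, s))\<bar>
        \<le> (\<integral>\<^sup>+ s. ennreal \<bar>g (t, s)\<bar> * indicator (below z) (t, s) \<partial>lborel)"
      using ae AE_lborel_singleton[of 0] by eventually_elim (rule inner)
  qed
  also have "\<dots> = (\<integral>\<^sup>+ w. ennreal \<bar>g w\<bar> * indicator (below z) w \<partial>(lborel \<Otimes>\<^sub>M lborel))"
    by (rule lborel.nn_integral_fst) (simp add: lborel_prod)
  also have "\<dots> = (\<integral>\<^sup>+ w. ennreal \<bar>g w\<bar> * indicator (below z) w \<partial>lborel)"
    by (simp add: lborel_prod)
  also have "\<dots> = (\<integral>\<^sup>+ w. ennreal \<bar>f w\<bar> * indicator (below z) w * indicator quadrant w \<partial>lborel)"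
  proof (rule nn_integral_cong_AE)
    show "AE w in lborel. ennreal \<bar>g w\<bar> * indicator (below z) w
        = ennreal \<bar>f w\<bar> * indicator (below z) w * indicator quadrant w"
      using fg
      by eventually_elim
        (use below_subset_quadrant[of z] in \<open>auto simp: indicator_def split: if_splits\<close>)
  qed
  also have "\<dots> = (\<integral>\<^sup>+ w. ennreal \<bar>f w\<bar> * indicator (below z) w * indicator quadrant w \<partial>lebesgue)"
    by (rule nn_integral_completion[symmetric])
  also have "\<dots> = (\<integral>\<^sup>+ w. ennreal \<bar>f w\<bar> * indicator (below z) w \<partial>quadrant_measure)"
    by (rule nn_integral_restrict_space[symmetric]) (simp add: sets_completionI_sets)
  finally show ?thesis .
qed

lemma nn_integral_inverse_sqrt:
  fixes x :: real
  assumes "0 \<le> x"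
  shows "(\<integral>\<^sup>+ s. ennreal (s powr (- (1/2))) * indicator {0<..x} s \<partial>lborel) = ennreal (2 * x powr (1/2))"
proof -
  have "((\<lambda>s. s powr (- (1/2))) has_integral (x powr (- (1/2) + 1) / (- (1/2) + 1))) {0..x}"
    using assms by (intro has_integral_powr_from_0) auto
  then have "((\<lambda>s. s powr (- (1/2))) has_integral (2 * x powr (1/2))) {0..x}"
    by (simp add: mult.commute)
  then have "(\<integral>\<^sup>+ s. ennreal (s powr (- (1/2))) * indicator {0..x} s \<partial>lborel) = ennreal (2 * x powr (1/2))"
    by (intro nn_integral_has_integral_lebesgue') auto
  also have "(\<integral>\<^sup>+ s. ennreal (s powr (- (1/2))) * indicator {0..x} s \<partial>lborel)
      = (\<integral>\<^sup>+ s. ennreal (s powr (- (1/2))) * indicator {0<..x} s \<partial>lborel)"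
    by (intro nn_integral_cong) (auto simp: indicator_def)
  finally show ?thesis .
qed

lemma nn_integral_inverse_sqrt_area:
  assumes "z \<in> quadrant"
  shows "(\<integral>\<^sup>+ w. ennreal (area w powr (- (1/2))) * indicator (below z) w \<partial>quadrant_measure)
     = ennreal (4 * area z powr (1/2))"
proof -
  obtain x y where z: "z = (x, y)" "0 \<le> x" "0 \<le> y"
    using assms by (cases z) (auto simp: quadrant_def)
  let ?h = "\<lambda>w. ennreal (area w powr (- (1/2))) * indicator (below z) w"
  have "(\<integral>\<^sup>+ w. ?h w \<partial>quadrant_measure) = (\<integral>\<^sup>+ w. ?h w * indicator quadrant w \<partial>lebesgue)"
    by (rule nn_integral_restrict_space) (simp add: sets_completionI_sets)
  also have "\<dots> = (\<integral>\<^sup>+ w. ?h w * indicator quadrant w \<partial>lborel)"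
    by (rule nn_integral_completion)
  also have "\<dots> = (\<integral>\<^sup>+ w. ?h w \<partial>lborel)"
    using below_subset_quadrant[of z] by (intro nn_integral_cong) (auto simp: indicator_def)
  also have "\<dots> = (\<integral>\<^sup>+ w. ?h w \<partial>(lborel \<Otimes>\<^sub>M lborel))"
    by (simp add: lborel_prod)
  also have "\<dots> = (\<integral>\<^sup>+ t. (\<integral>\<^sup>+ s. ?h (t, s) \<partial>lborel) \<partial>lborel)"
    by (rule lborel.nn_integral_fst[symmetric]) (simp add: lborel_prod)
  also have "\<dots> = (\<integral>\<^sup>+ t. (\<integral>\<^sup>+ s. ennreal (t powr (- (1/2))) * indicator {0<..x} t *
        (ennreal (s powr (- (1/2))) * indicator {0<..y} s) \<partial>lborel) \<partial>lborel)"
    by (intro nn_integral_cong)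
      (auto simp: area_def below_def z indicator_def powr_mult ennreal_mult)
  also have "\<dots> = ennreal (2 * x powr (1/2)) * ennreal (2 * y powr (1/2))"
    using z by (simp add: nn_integral_cmult nn_integral_multc nn_integral_inverse_sqrt
      del: ennreal_mult')
  also have "\<dots> = ennreal (4 * area z powr (1/2))"
    using z by (simp add: area_def powr_mult flip: ennreal_mult)
  finally show ?thesis .
qed

text \<open>On \<open>below z\<close> one has
  \<open>\<bar>f\<bar> = F powr (1/r) * G powr (1/p - 1/r) * H powr (1/p')\<close> with
  \<open>F = \<bar>f\<bar> powr p * area powr (\<gamma> r)\<close>, \<open>G = \<bar>f\<bar> powr p\<close>, \<open>H = 1 / \<surd>area\<close>, and the three
  exponents add up to \<open>1\<close>. Here \<open>G\<close> has integral at most \<open>1\<close> by hypothesis, and \<open>H\<close> has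
  integral \<open>4 \<surd>(area z)\<close>; since \<open>1/p' = 2 \<gamma>\<close>, it contributes \<open>(16 area z) powr \<gamma>\<close>. The parameter \<open>u\<close> will be the scaled weight at \<open>z\<close>; it is
  carried inside the power since \<open>r\<close> will be the exponent at \<open>z\<close>.\<close>

lemma hardy2_modular_pointwise:
  fixes f :: "real \<times> real \<Rightarrow> real" and p r u :: real
  defines "\<gamma> \<equiv> (p - 1) / (2 * p)"
  assumes p: "1 < p" "p \<le> r"
    and f [measurable]: "f \<in> borel_measurable quadrant_measure"
    and f_le: "(\<integral>\<^sup>+ w. ennreal (\<bar>f w\<bar> powr p) \<partial>quadrant_measure) \<le> 1"
    and z: "z \<in> quadrant" and u: "0 \<le> u"
  shows "ennreal ((\<bar>hardy2 f z\<bar> * u) powr r)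
    \<le> (\<integral>\<^sup>+ w. ennreal (\<bar>f w\<bar> powr p) * ennreal (((16 * area w * area z) powr \<gamma> * u) powr r)
          * indicator (below z) w \<partial>quadrant_measure)" (is "_ \<le> ?R")
proof (cases "area z = 0 \<or> u = 0")
  case True
  then have "below z = {} \<or> u = 0"
    by (auto simp: area_def below_def)
  then have "\<bar>hardy2 f z\<bar> * u = 0"
    using hardy2_le_nn_integral[OF f, of z] by (auto simp: ennreal_eq_0_iff)
  then have "(\<bar>hardy2 f z\<bar> * u) powr r = 0" by (simp only: powr_0)
  then show ?thesis by (simp only: ennreal_0 zero_le)
next
  case False
  then have pos: "0 < area z" "0 < u"
    using z u by (auto simp: area_def quadrant_def less_le)
  define k where "k = ((16 * area z) powr \<gamma> * u) powr r"
  have k: "0 < k" unfolding k_def using pos by simp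
  have g: "0 < \<gamma>" using p by (simp add: \<gamma>_def)
  define F where "F w = \<bar>f w\<bar> powr p * area w powr (\<gamma> * r) * indicator (below z) w" for w
  define H where "H w = area w powr (- (1/2)) * indicator (below z) w" for w
  have below_meas [measurable]: "(indicator (below z) :: _ \<Rightarrow> real) \<in> borel_measurable quadrant_measure"
    by (rule measurable_quadrant_borel) simp
  have F_meas [measurable]: "F \<in> borel_measurable quadrant_measure"
    unfolding F_def by measurable
  have H_meas [measurable]: "H \<in> borel_measurable quadrant_measure"
    unfolding H_def by measurable
  have R: "?R = ennreal k * (\<integral>\<^sup>+ w. ennreal (F w) \<partial>quadrant_measure)"
  proof -
    have "?R = (\<integral>\<^sup>+ w. ennreal k * ennreal (F w) \<partial>quadrant_measure)"
    proof (rule nn_integral_cong)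
      fix w
      show "ennreal (\<bar>f w\<bar> powr p) * ennreal (((16 * area w * area z) powr \<gamma> * u) powr r)
          * indicator (below z) w = ennreal k * ennreal (F w)"
      proof (cases "w \<in> below z")
        case True
        then have "0 < area w" by (auto simp: below_def area_def)
        then have "((16 * area w * area z) powr \<gamma> * u) powr r = k * area w powr (\<gamma> * r)"
          unfolding k_def using pos by (simp add: powr_mult powr_powr)
        then show ?thesis using True k
          by (simp add: F_def ac_simps flip: ennreal_mult)
      qed (simp add: F_def)
    qed
    then show ?thesis by (simp add: nn_integral_cmult)
  qed
  have H_int: "(\<integral>\<^sup>+ w. ennreal (H w) \<partial>quadrant_measure) = ennreal (4 * area z powr (1/2))"
  proof -
    have "(\<integral>\<^sup>+ w. ennreal (H w) \<partial>quadrant_measure)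
      = (\<integral>\<^sup>+ w. ennreal (area w powr (- (1/2))) * indicator (below z) w \<partial>quadrant_measure)"
      by (intro nn_integral_cong) (simp add: H_def indicator_def)
    then show ?thesis using nn_integral_inverse_sqrt_area[OF z] by simp
  qed
  \<comment> \<open>The integral of \<open>F\<close> may vanish, whereas the Hoelder inequality wants a positive bound;
    hence an arbitrary \<open>X > 0\<close> above the integral, removed by a limit afterwards.\<close>
  have bound: "(\<bar>hardy2 f z\<bar> * u) powr r \<le> X * k"
    if X: "0 < X" "(\<integral>\<^sup>+ w. ennreal (F w) \<partial>quadrant_measure) \<le> ennreal X" for X
  proof -
    have abs_f: "\<bar>f w\<bar> = F w powr (1 / r) * (\<bar>f w\<bar> powr p) powr (1 / p - 1 / r) * H w powr (2 * \<gamma>)"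
      if "w \<in> below z" for w
    proof -
      have aw: "0 < area w" using that by (auto simp: below_def area_def)
      have "F w powr (1 / r) * (\<bar>f w\<bar> powr p) powr (1 / p - 1 / r) * H w powr (2 * \<gamma>)
          = (\<bar>f w\<bar> powr (p / r) * \<bar>f w\<bar> powr (1 - p / r)) * (area w powr \<gamma> * area w powr (- \<gamma>))"
        using that p by (simp add: F_def H_def powr_mult powr_powr right_diff_distrib)
      also have "\<dots> = \<bar>f w\<bar>" using aw by (simp flip: powr_add)
      finally show ?thesis by simp
    qed
    have "ennreal \<bar>hardy2 f z\<bar> \<le> (\<integral>\<^sup>+ w. ennreal \<bar>f w\<bar> * indicator (below z) w \<partial>quadrant_measure)"
      by (rule hardy2_le_nn_integral[OF f])
    also have "\<dots> \<le> (\<integral>\<^sup>+ w. ennreal (F w powr (1 / r) * (\<bar>f w\<bar> powr p) powr (1 / p - 1 / r)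
        * H w powr (2 * \<gamma>)) \<partial>quadrant_measure)"
      by (intro nn_integral_mono) (use abs_f in \<open>auto simp: indicator_def\<close>)
    also have "\<dots> \<le> ennreal (X powr (1 / r) * 1 powr (1 / p - 1 / r) * (4 * area z powr (1/2)) powr (2 * \<gamma>))"
    proof (rule nn_integral_Holder3)
      show "1 / r + (1 / p - 1 / r) + 2 * \<gamma> = 1"
        using p by (simp add: \<gamma>_def field_simps)
      show "0 \<le> 1 / p - 1 / r" using p by (simp add: divide_simps)
    qed (use X p g pos f_le H_int in \<open>auto simp: F_def H_def\<close>)
    finally have "\<bar>hardy2 f z\<bar> \<le> X powr (1 / r) * (4 * area z powr (1/2)) powr (2 * \<gamma>)"
      using X by (simp add: ennreal_le_iff)
    also have "(4 * area z powr (1/2)) powr (2 * \<gamma>) = (16 * area z) powr \<gamma>"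
    proof -
      have "(4::real) powr (2 * \<gamma>) = 16 powr \<gamma>" by (simp flip: powr_powr)
      then show ?thesis using pos by (simp add: powr_mult powr_powr)
    qed
    finally have "(\<bar>hardy2 f z\<bar> * u) powr r \<le> (X powr (1 / r) * (16 * area z) powr \<gamma> * u) powr r"
      using u p by (intro powr_mono2 mult_right_mono) auto
    also have "\<dots> = X * k"
      unfolding k_def using X p pos by (simp add: powr_mult powr_powr)
    finally show ?thesis .
  qed
  show ?thesis
  proof (cases "(\<integral>\<^sup>+ w. ennreal (F w) \<partial>quadrant_measure)")
    case (real i)
    have "(\<bar>hardy2 f z\<bar> * u) powr r \<le> i * k"
    proof (rule field_le_epsilon)
      fix e :: real assume e: "0 < e"
      have "(\<bar>hardy2 f z\<bar> * u) powr r \<le> (i + e / k) * k"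
        using real e k by (intro bound) (auto simp: add_nonneg_pos intro!: ennreal_leI)
      then show "(\<bar>hardy2 f z\<bar> * u) powr r \<le> i * k + e"
        using k by (simp add: distrib_right)
    qed
    then show ?thesis unfolding R real(2)
      using real(1) k by (simp add: mult.commute flip: ennreal_mult)
  next
    case top
    then show ?thesis unfolding R using k by (simp add: ennreal_mult_top)
  qed
qed

section \<open>Summing the test condition over dyadic pieces\<close>

lemma ex_dyadic_index:
  fixes a x :: real
  assumes "0 < a" "a \<le> x"
  obtains i :: nat where "2 ^ i * a \<le> x" "x < 2 * (2 ^ i * a)"
proof -
  define n where "n = (LEAST n. x < 2 ^ n * a)"
  obtain m where "x / a < 2 ^ m" using real_arch_pow[of 2 "x / a"] by auto
  then have "x < 2 ^ m * a" using assms by (simp add: field_simps)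
  then have n: "x < 2 ^ n * a" unfolding n_def by (rule LeastI)
  then obtain i where i: "n = Suc i" using assms by (cases n) auto
  have "\<not> x < 2 ^ i * a" using not_less_Least[of i "\<lambda>n. x < 2 ^ n * a"] i by (simp add: n_def)
  with n i show thesis by (intro that[of i]) auto
qed

text \<open>If \<open>2\<^sup>i t \<le> x < 2\<^sup>i\<^sup>+\<^sup>1 t\<close> and \<open>2\<^sup>j s \<le> y < 2\<^sup>j\<^sup>+\<^sup>1 s\<close>, then with
  \<open>m = 2\<^sup>i t 2\<^sup>j s\<close> one has \<open>x y \<le> 4 m\<close> and \<open>t s = (1/2)\<^sup>i (1/2)\<^sup>j m\<close>, whence
  \<open>(t s x y) powr \<gamma> \<le> 4 powr \<gamma> * m powr (2 \<gamma>) * \<rho>\<^sup>i \<rho>\<^sup>j\<close>. The constant \<open>(1 - \<rho>)\<^sup>2\<close> turns \<open>\<rho>\<^sup>i \<rho>\<^sup>j\<close> into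
  weights of total mass \<open>1\<close>. Each weight is at most \<open>1\<close> and \<open>q \<ge> 1\<close>, so it can be pulled
  out of the power with exponent \<open>q\<close>, and the pieces average quantities that are at most
  \<open>1\<close>.\<close>

lemma modular_on_J_inf_le_1:
  fixes u q :: "real \<times> real \<Rightarrow> real" and \<gamma> :: real
  defines "\<rho> \<equiv> 2 powr (- \<gamma>)"
  assumes g: "0 < \<gamma>" and t: "0 < t" and s: "0 < s"
    and [measurable]: "u \<in> borel_measurable quadrant_measure" "q \<in> borel_measurable quadrant_measure"
    and u: "\<And>z. 0 \<le> u z" and q: "\<And>z. z \<in> quadrant \<Longrightarrow> 1 \<le> q z"
    and test: "\<And>a b. 0 < a \<Longrightarrow> 0 < b \<Longrightarrow>
      (\<integral>\<^sup>+ z. ennreal (((a * b) powr (2 * \<gamma>) * u z) powr q z) * indicator (J_inf a b) z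
         \<partial>quadrant_measure) \<le> 1"
  shows "(\<integral>\<^sup>+ z. ennreal (((t * s * area z) powr \<gamma> * ((1 - \<rho>)\<^sup>2 / 4 powr \<gamma> * u z)) powr q z)
         * indicator (J_inf t s) z \<partial>quadrant_measure) \<le> 1"
proof -
  have rho: "0 < \<rho>" "\<rho> < 1" using g by (auto simp: \<rho>_def powr_less_one)
  define w where "w i = (1 - \<rho>) * \<rho> ^ i" for i :: nat
  have w0: "0 \<le> w i" for i using rho by (simp add: w_def)
  have w1: "w i \<le> 1" for i
    unfolding w_def using rho by (intro mult_le_one power_le_one) auto
  have w_sum: "(\<Sum>i. ennreal (w i)) = 1"
  proof -
    have "(\<lambda>i. (1 - \<rho>) * \<rho> ^ i) sums ((1 - \<rho>) * (1 / (1 - \<rho>)))"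
      using rho by (intro sums_mult geometric_sums) auto
    then have "w sums 1" using rho by (simp add: w_def[abs_def])
    from suminf_ennreal_eq[OF w0 this] show ?thesis by (simp only: ennreal_1)
  qed
  define T where "T i j z = ennreal (((2 ^ i * t * (2 ^ j * s)) powr (2 * \<gamma>) * u z) powr q z)
      * indicator (J_inf (2 ^ i * t) (2 ^ j * s)) z" for i j :: nat and z
  have T_meas [measurable]: "T i j \<in> borel_measurable quadrant_measure" for i j
    unfolding T_def by measurable
  have pointwise: "ennreal (((t * s * area z) powr \<gamma> * ((1 - \<rho>)\<^sup>2 / 4 powr \<gamma> * u z)) powr q z)
         * indicator (J_inf t s) z \<le> (\<Sum>i. \<Sum>j. ennreal (w i) * ennreal (w j) * T i j z)"
    if z: "z \<in> quadrant" for z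
  proof (cases "z \<in> J_inf t s")
    case True
    then have "t \<le> fst z" "s \<le> snd z" by (auto simp: J_inf_def)
    obtain i where i: "2 ^ i * t \<le> fst z" "fst z < 2 * (2 ^ i * t)"
      using ex_dyadic_index[OF t \<open>t \<le> fst z\<close>] .
    obtain j where j: "2 ^ j * s \<le> snd z" "snd z < 2 * (2 ^ j * s)"
      using ex_dyadic_index[OF s \<open>s \<le> snd z\<close>] .
    define m where "m = 2 ^ i * t * (2 ^ j * s)"
    have m: "0 < m" using t s by (simp add: m_def)
    have az: "0 \<le> area z" "area z \<le> 4 * m"
    proof -
      show "0 \<le> area z" using z by (auto simp: area_def quadrant_def)
      have "fst z * snd z \<le> (2 * (2 ^ i * t)) * (2 * (2 ^ j * s))"
        using i j t s z by (intro mult_mono) (auto simp: quadrant_def)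
      then show "area z \<le> 4 * m" by (simp add: area_def m_def)
    qed
    have "(t * s * area z) powr \<gamma> \<le> (t * s * (4 * m)) powr \<gamma>"
      using az t s g by (intro powr_mono2 mult_left_mono) auto
    also have "t * s * (4 * m) = 4 * (m * m) * (1/2) ^ i * (1/2) ^ j"
      by (simp add: m_def power_one_over field_simps)
    also have "(4 * (m * m) * (1/2) ^ i * (1/2) ^ j) powr \<gamma> = 4 powr \<gamma> * m powr (2 * \<gamma>) * \<rho> ^ i * \<rho> ^ j"
    proof -
      have half: "((1/2) ^ n) powr \<gamma> = \<rho> ^ n" for n :: nat
      proof -
        have "((1/2) ^ n :: real) powr \<gamma> = ((1/2) powr \<gamma>) ^ n"
          by (induction n) (simp_all add: powr_mult powr_divide)
        then show ?thesis by (simp add: \<rho>_def powr_minus powr_divide inverse_eq_divide)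
      qed
      have "(m * m) powr \<gamma> = m powr (2 * \<gamma>)"
        by (simp only: powr_mult mult_2 powr_add)
      then show ?thesis by (simp only: powr_mult half)
    qed
    finally have "(t * s * area z) powr \<gamma> * ((1 - \<rho>)\<^sup>2 / 4 powr \<gamma> * u z)
        \<le> 4 powr \<gamma> * m powr (2 * \<gamma>) * \<rho> ^ i * \<rho> ^ j * ((1 - \<rho>)\<^sup>2 / 4 powr \<gamma> * u z)"
      using u[of z] by (intro mult_right_mono) auto
    also have "\<dots> = w i * w j * (m powr (2 * \<gamma>) * u z)"
      by (simp add: w_def power2_eq_square)
    finally have "((t * s * area z) powr \<gamma> * ((1 - \<rho>)\<^sup>2 / 4 powr \<gamma> * u z)) powr q z
        \<le> (w i * w j * (m powr (2 * \<gamma>) * u z)) powr q z"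
      using q[OF z] u[of z] by (intro powr_mono2) auto
    also have "\<dots> = (w i * w j) powr q z * (m powr (2 * \<gamma>) * u z) powr q z"
      by (rule powr_mult)
    also have "\<dots> \<le> (w i * w j) * (m powr (2 * \<gamma>) * u z) powr q z"
    proof (rule mult_right_mono)
      have "(w i * w j) powr q z \<le> (w i * w j) powr 1"
        using q[OF z] w0 w1 by (intro powr_mono') (auto intro: mult_le_one)
      then show "(w i * w j) powr q z \<le> w i * w j" using w0 by simp
    qed simp
    finally have "ennreal (((t * s * area z) powr \<gamma> * ((1 - \<rho>)\<^sup>2 / 4 powr \<gamma> * u z)) powr q z)
        \<le> ennreal (w i) * ennreal (w j) * T i j z"
      using i j w0 by (simp add: T_def m_def J_inf_def mem_Times_iff indicator_def ennreal_leI flip: ennreal_mult)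
    also have "\<dots> \<le> (\<Sum>j. ennreal (w i) * ennreal (w j) * T i j z)"
      using sum_le_suminf[of "\<lambda>j. ennreal (w i) * ennreal (w j) * T i j z" "{j}"] by simp
    also have "\<dots> \<le> (\<Sum>i. \<Sum>j. ennreal (w i) * ennreal (w j) * T i j z)"
      using sum_le_suminf[of "\<lambda>i. \<Sum>j. ennreal (w i) * ennreal (w j) * T i j z" "{i}"] by simp
    finally show ?thesis using True by simp
  qed simp
  have "(\<integral>\<^sup>+ z. ennreal (((t * s * area z) powr \<gamma> * ((1 - \<rho>)\<^sup>2 / 4 powr \<gamma> * u z)) powr q z)
         * indicator (J_inf t s) z \<partial>quadrant_measure)
      \<le> (\<integral>\<^sup>+ z. (\<Sum>i. \<Sum>j. ennreal (w i) * ennreal (w j) * T i j z) \<partial>quadrant_measure)"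
    by (rule nn_integral_mono) (use pointwise in simp)
  also have "\<dots> = (\<Sum>i. \<Sum>j. ennreal (w i) * ennreal (w j) * (\<integral>\<^sup>+ z. T i j z \<partial>quadrant_measure))"
    by (simp add: nn_integral_suminf nn_integral_cmult)
  also have "\<dots> \<le> (\<Sum>i. \<Sum>j. ennreal (w i) * ennreal (w j) * 1)"
    using t s by (intro suminf_le mult_left_mono allI) (auto simp: T_def intro!: test)
  also have "\<dots> = 1" by (simp add: w_sum)
  finally show ?thesis .
qed

section \<open>The test condition characterises boundedness\<close>

text \<open>Tonelli's theorem is applied to the pointwise bound on the product of
  \<open>quadrant_measure\<close> with itself. Swapping turns the region \<open>w \<in> below z\<close> into
  \<open>z \<in> J_inf\<close> with corner \<open>w\<close>, where the dyadic estimate bounds the integral in \<open>z\<close> by \<open>1\<close>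
  and leaves the integral of \<open>\<bar>f\<bar> powr p\<close>. In \<open>D\<close>, the factor \<open>64 = 16 \<cdot> 4\<close> collects the
  constants of the pointwise and of the dyadic estimate.\<close>

lemma hardy2_modular_le_1:
  fixes f q v :: "real \<times> real \<Rightarrow> real" and p A :: real
  defines "\<gamma> \<equiv> (p - 1) / (2 * p)"
  defines "D \<equiv> 64 powr \<gamma> * A / (1 - 2 powr (- \<gamma>))\<^sup>2"
  assumes p: "1 < p" and q: "\<And>z. z \<in> quadrant \<Longrightarrow> p \<le> q z" and A: "0 < A"
    and q_meas [measurable]: "q \<in> borel_measurable quadrant_measure"
    and v_meas [measurable]: "v \<in> borel_measurable quadrant_measure"
    and f_meas [measurable]: "f \<in> borel_measurable quadrant_measure"
    and test: "\<And>a b. 0 < a \<Longrightarrow> 0 < b \<Longrightarrow>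
      (\<integral>\<^sup>+ z. ennreal (((a * b) powr (1 / conj_exp p) * (\<bar>v z\<bar> / A)) powr q z) * indicator (J_inf a b) z
         \<partial>quadrant_measure) \<le> 1"
    and f_le: "(\<integral>\<^sup>+ w. ennreal (\<bar>f w\<bar> powr p) \<partial>quadrant_measure) \<le> 1"
  shows "(\<integral>\<^sup>+ z. ennreal (\<bar>hardy2 f z * v z / D\<bar> powr q z) \<partial>quadrant_measure) \<le> 1"
proof -
  interpret Q: sigma_finite_measure quadrant_measure by (rule sigma_finite_quadrant)
  interpret QQ: pair_sigma_finite quadrant_measure quadrant_measure ..
  have g: "0 < \<gamma>" using p by (simp add: \<gamma>_def)
  have conj: "1 / conj_exp p = 2 * \<gamma>" using p by (simp add: \<gamma>_def conj_exp_def divide_simps)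
  have rho: "2 powr (- \<gamma>) < 1" using g by (auto simp: powr_less_one)
  have D: "0 < D" unfolding D_def using A rho by (intro divide_pos_pos mult_pos_pos) auto
  define K where "K z w = ennreal (\<bar>f w\<bar> powr p) *
    (ennreal (((16 * area w * area z) powr \<gamma> * (\<bar>v z\<bar> / D)) powr q z) * indicator (below z) w)" for z w
  have below_pair: "{zw \<in> space (quadrant_measure \<Otimes>\<^sub>M quadrant_measure). snd zw \<in> below (fst zw)}
      \<in> sets (quadrant_measure \<Otimes>\<^sub>M quadrant_measure)"
  proof -
    have [measurable]: "fst \<in> borel_measurable quadrant_measure" "snd \<in> borel_measurable quadrant_measure"
      by (auto intro!: measurable_quadrant_borel borel_measurable_continuous_onI continuous_intros)
    have [measurable]: "(\<lambda>zw. fst (fst zw)) \<in> borel_measurable (quadrant_measure \<Otimes>\<^sub>M quadrant_measure)"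
      "(\<lambda>zw. snd (fst zw)) \<in> borel_measurable (quadrant_measure \<Otimes>\<^sub>M quadrant_measure)"
      "(\<lambda>zw. fst (snd zw)) \<in> borel_measurable (quadrant_measure \<Otimes>\<^sub>M quadrant_measure)"
      "(\<lambda>zw. snd (snd zw)) \<in> borel_measurable (quadrant_measure \<Otimes>\<^sub>M quadrant_measure)"
      by (rule measurable_compose[OF measurable_fst] measurable_compose[OF measurable_snd], fact)+
    show ?thesis
      unfolding below_def mem_Times_iff greaterThanAtMost_iff by measurable
  qed
  have ind_meas [measurable]: "(\<lambda>zw. indicator (below (fst zw)) (snd zw) :: ennreal)
      \<in> borel_measurable (quadrant_measure \<Otimes>\<^sub>M quadrant_measure)"
    by (rule measurable_cong[THEN iffD2, OF _ borel_measurable_indicator[OF below_pair]])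
      (simp add: indicator_def)
  have K_meas: "case_prod K \<in> borel_measurable (quadrant_measure \<Otimes>\<^sub>M quadrant_measure)"
    unfolding K_def case_prod_beta by measurable
  have "(\<integral>\<^sup>+ z. ennreal (\<bar>hardy2 f z * v z / D\<bar> powr q z) \<partial>quadrant_measure)
      \<le> (\<integral>\<^sup>+ z. (\<integral>\<^sup>+ w. K z w \<partial>quadrant_measure) \<partial>quadrant_measure)"
  proof (rule nn_integral_mono)
    fix z assume "z \<in> space quadrant_measure"
    then have z: "z \<in> quadrant" by simp
    have "\<bar>hardy2 f z * v z / D\<bar> = \<bar>hardy2 f z\<bar> * (\<bar>v z\<bar> / D)"
      using D by (simp add: abs_mult)
    then show "ennreal (\<bar>hardy2 f z * v z / D\<bar> powr q z) \<le> (\<integral>\<^sup>+ w. K z w \<partial>quadrant_measure)"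
      using hardy2_modular_pointwise[OF p q[OF z] f_meas f_le z, of "\<bar>v z\<bar> / D"] D
      by (simp add: K_def \<gamma>_def mult.assoc)
  qed
  also have "\<dots> = (\<integral>\<^sup>+ w. (\<integral>\<^sup>+ z. K z w \<partial>quadrant_measure) \<partial>quadrant_measure)"
    using QQ.Fubini'[OF K_meas] by simp
  also have "\<dots> \<le> (\<integral>\<^sup>+ w. ennreal (\<bar>f w\<bar> powr p) \<partial>quadrant_measure)"
  proof (rule nn_integral_mono)
    fix w
    show "(\<integral>\<^sup>+ z. K z w \<partial>quadrant_measure) \<le> ennreal (\<bar>f w\<bar> powr p)"
    proof (cases "0 < fst w \<and> 0 < snd w")
      case False
      then have "w \<notin> below z" for z by (auto simp: below_def)
      then have "K z w = 0" for z by (simp add: K_def)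
      then show ?thesis by simp
    next
      case True
      let ?S = "\<lambda>z. ennreal (((fst w * snd w * area z) powr \<gamma> *
          ((1 - 2 powr (- \<gamma>))\<^sup>2 / 4 powr \<gamma> * (\<bar>v z\<bar> / A))) powr q z) * indicator (J_inf (fst w) (snd w)) z"
      have "(\<integral>\<^sup>+ z. K z w \<partial>quadrant_measure) = (\<integral>\<^sup>+ z. ennreal (\<bar>f w\<bar> powr p) * ?S z \<partial>quadrant_measure)"
      proof (rule nn_integral_cong)
        fix z assume "z \<in> space quadrant_measure"
        then have az: "0 \<le> area z" by (auto simp: quadrant_def area_def)
        have 64: "(64::real) powr \<gamma> = 16 powr \<gamma> * 4 powr \<gamma>" by (simp flip: powr_mult)
        have aw: "0 < area w" using True by (simp add: area_def)
        have "(16 * area w * area z) powr \<gamma> * (\<bar>v z\<bar> / D)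
          = (area w * area z) powr \<gamma> * (16 powr \<gamma> * (\<bar>v z\<bar> / D))"
          using aw az by (simp add: powr_mult)
        also have "16 powr \<gamma> * (\<bar>v z\<bar> / D) = (1 - 2 powr (- \<gamma>))\<^sup>2 / 4 powr \<gamma> * (\<bar>v z\<bar> / A)"
          unfolding D_def 64 using A rho by (simp add: field_simps)
        finally have "(16 * area w * area z) powr \<gamma> * (\<bar>v z\<bar> / D)
          = (fst w * snd w * area z) powr \<gamma> * ((1 - 2 powr (- \<gamma>))\<^sup>2 / 4 powr \<gamma> * (\<bar>v z\<bar> / A))"
          by (simp only: area_def)
        moreover have "(indicator (below z) w :: ennreal) = indicator (J_inf (fst w) (snd w)) z"
          using True by (auto simp: indicator_def below_def J_inf_def mem_Times_iff)
        ultimately show "K z w = ennreal (\<bar>f w\<bar> powr p) * ?S z"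
          by (simp only: K_def)
      qed
      also have "\<dots> = ennreal (\<bar>f w\<bar> powr p) * (\<integral>\<^sup>+ z. ?S z \<partial>quadrant_measure)"
        by (rule nn_integral_cmult) measurable
      also have "\<dots> \<le> ennreal (\<bar>f w\<bar> powr p) * 1"
      proof (intro mult_left_mono modular_on_J_inf_le_1)
        show "1 \<le> q z" if "z \<in> quadrant" for z using q[OF that] p by simp
      qed (use True A g test conj in auto)
      finally show ?thesis by simp
    qed
  qed
  also have "\<dots> \<le> 1" by (rule f_le)
  finally show ?thesis .
qed

lemma hardy2_cmult: "hardy2 (\<lambda>z. k * f z) z = k * hardy2 f z"
  by (cases z) (simp add: hardy2_def)

lemma nn_integral_Lp:
  assumes "f \<in> Lp_space p" "0 < p"
  shows "(\<integral>\<^sup>+ z. ennreal (\<bar>f z\<bar> powr p) \<partial>quadrant_measure) = ennreal (Lp_norm p f powr p)"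
proof -
  have "(\<integral>\<^sup>+ z. ennreal (\<bar>f z\<bar> powr p) \<partial>quadrant_measure)
      = ennreal (LINT z|quadrant_measure. \<bar>f z\<bar> powr p)"
    using assms by (intro nn_integral_eq_integral) (auto simp: Lp_space_def)
  also have "(LINT z|quadrant_measure. \<bar>f z\<bar> powr p) = Lp_norm p f powr p"
    using assms(2) by (simp add: Lp_norm_def powr_powr)
  finally show ?thesis .
qed

lemma hardy2_bounded_if_test:
  fixes q v :: "real \<times> real \<Rightarrow> real" and p A :: real
  assumes p: "1 < p" and q: "\<And>z. z \<in> quadrant \<Longrightarrow> p \<le> q z" and A: "0 < A"
    and q_meas: "q \<in> borel_measurable quadrant_measure"
    and v_meas: "v \<in> borel_measurable quadrant_measure"
    and test: "\<And>a b. 0 < a \<Longrightarrow> 0 < b \<Longrightarrow>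
      var_norm q (\<lambda>z. v z * indicator (J_inf a b) z) * ennreal ((a * b) powr (1 / conj_exp p)) < ennreal A"
  shows "hardy2_bounded p q v"
proof -
  have modular: "(\<integral>\<^sup>+ z. ennreal (((a * b) powr (1 / conj_exp p) * (\<bar>v z\<bar> / A)) powr q z) * indicator (J_inf a b) z
         \<partial>quadrant_measure) \<le> 1" if ab: "0 < a" "0 < b" for a b
  proof -
    define k where "k = (a * b) powr (1 / conj_exp p)"
    have k: "0 < k" unfolding k_def using ab by simp
    have less: "var_norm q (\<lambda>z. v z * indicator (J_inf a b) z) < ennreal (A / k)"
    proof (rule ccontr)
      assume "\<not> ?thesis"
      then have "ennreal (A / k) * ennreal k \<le> var_norm q (\<lambda>z. v z * indicator (J_inf a b) z) * ennreal k"
        by (intro mult_right_mono) auto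
      moreover have "ennreal (A / k) * ennreal k = ennreal A"
        using A k by (simp flip: ennreal_mult)
      ultimately show False using test[OF ab] by (simp add: k_def)
    qed
    have "(\<integral>\<^sup>+ z. ennreal ((k * (\<bar>v z\<bar> / A)) powr q z) * indicator (J_inf a b) z \<partial>quadrant_measure)
      = (\<integral>\<^sup>+ z. ennreal (\<bar>v z * indicator (J_inf a b) z / (A / k)\<bar> powr q z) \<partial>quadrant_measure)"
      using A k by (intro nn_integral_cong) (simp add: indicator_def abs_mult mult.commute)
    also have "\<dots> \<le> 1"
    proof (rule modular_le_1_if_var_norm_less[OF less])
      show "0 \<le> q z" if "z \<in> quadrant" for z using q[OF that] p by simp
    qed
    finally show ?thesis by (simp add: k_def)
  qed
  define D where "D = 64 powr ((p - 1) / (2 * p)) * A / (1 - 2 powr (- ((p - 1) / (2 * p))))\<^sup>2"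
  have "2 powr (- ((p - 1) / (2 * p))) < (1::real)" using p by (auto simp: powr_less_one)
  then have D: "0 < D" unfolding D_def using A by (intro divide_pos_pos mult_pos_pos) auto
  have "weighted_var_norm q v (hardy2 f) \<le> ennreal (D * Lp_norm p f)" if f: "f \<in> Lp_space p" for f
  proof -
    have norm0: "0 \<le> Lp_norm p f" by (simp add: Lp_norm_def)
    have f_meas [measurable]: "f \<in> borel_measurable quadrant_measure"
      using f by (simp add: Lp_space_def)
    \<comment> \<open>Dividing by \<open>N\<close> strictly above the norm, instead of by the norm itself, covers
      functions of norm zero.\<close>
    have le: "var_norm q (\<lambda>z. hardy2 f z * v z) \<le> ennreal (D * N)" if N: "Lp_norm p f < N" for N
    proof (rule var_norm_le)
      have N0: "0 < N" using N norm0 by simp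
      show "0 < D * N" using D N0 by simp
      have "(\<integral>\<^sup>+ w. ennreal (\<bar>(1 / N) * f w\<bar> powr p) \<partial>quadrant_measure)
        = (\<integral>\<^sup>+ w. ennreal ((1 / N) powr p) * ennreal (\<bar>f w\<bar> powr p) \<partial>quadrant_measure)"
        using N0 by (intro nn_integral_cong) (simp add: abs_mult powr_mult powr_divide flip: ennreal_mult)
      also have "\<dots> = ennreal ((1 / N) powr p) * ennreal (Lp_norm p f powr p)"
        using nn_integral_Lp[OF f] p by (simp add: nn_integral_cmult)
      also have "\<dots> \<le> ennreal ((1 / N) powr p) * ennreal (N powr p)"
        using N norm0 p by (intro mult_left_mono ennreal_leI powr_mono2) auto
      also have "\<dots> = 1" using N0 by (simp flip: ennreal_mult powr_mult)
      finally have "(\<integral>\<^sup>+ z. ennreal (\<bar>hardy2 (\<lambda>w. (1 / N) * f w) z * v z / D\<bar> powr q z) \<partial>quadrant_measure) \<le> 1"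
        unfolding D_def by (intro hardy2_modular_le_1 p q A q_meas v_meas modular) measurable
      then show "(\<integral>\<^sup>+ z. ennreal (\<bar>hardy2 f z * v z / (D * N)\<bar> powr q z) \<partial>quadrant_measure) \<le> 1"
        unfolding hardy2_cmult by (simp add: mult.commute)
    qed
    show ?thesis
      unfolding weighted_var_norm_def
    proof (rule ennreal_le_epsilon)
      fix e :: real assume e: "0 < e"
      have "var_norm q (\<lambda>z. hardy2 f z * v z) \<le> ennreal (D * (Lp_norm p f + e / D))"
        using e D by (intro le) auto
      also have "\<dots> = ennreal (D * Lp_norm p f) + ennreal e"
        using e D norm0 by (simp add: distrib_left flip: ennreal_plus)
      finally show "var_norm q (\<lambda>z. hardy2 f z * v z) \<le> ennreal (D * Lp_norm p f) + ennreal e" .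
    qed
  qed
  then show ?thesis unfolding hardy2_bounded_def using D by blast
qed

lemma rectangle_test_function:
  assumes "0 < a" "0 < b" "0 < p"
  defines "f \<equiv> indicator ({0..a} \<times> {0..b}) :: real \<times> real \<Rightarrow> real"
  shows "f \<in> Lp_space p" "Lp_norm p f = (a * b) powr (1 / p)"
    "\<And>z. z \<in> J_inf a b \<Longrightarrow> hardy2 f z = a * b"
proof -
  let ?R = "{0..a} \<times> {0..b}"
  have R_borel [measurable]: "?R \<in> sets borel" by (intro borel_closed closed_Times) auto
  have R_sub: "?R \<subseteq> quadrant" by (auto simp: quadrant_def)
  have R_emeasure: "emeasure quadrant_measure ?R = ennreal (a * b)"
  proof -
    have "emeasure quadrant_measure ?R = emeasure lebesgue ?R"
      using R_sub by (intro emeasure_restrict_space) (auto simp: sets_completionI_sets)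
    also have "\<dots> = emeasure (lborel \<Otimes>\<^sub>M lborel) ?R"
      using R_borel by (simp add: lborel_prod)
    also have "\<dots> = emeasure lborel {0..a} * emeasure lborel {0..b}"
      by (rule lborel.emeasure_pair_measure_Times) auto
    also have "\<dots> = ennreal (a * b)" using assms by (simp flip: ennreal_mult)
    finally show ?thesis .
  qed
  have R_sets: "?R \<in> sets quadrant_measure"
    using R_sub by (auto simp: sets_restrict_space_iff sets_completionI_sets)
  have f_powr: "(\<lambda>z. \<bar>f z\<bar> powr p) = indicator ?R"
    using assms by (auto simp: f_def indicator_def)
  show "f \<in> Lp_space p"
    unfolding Lp_space_def f_powr mem_Collect_eq
    using R_sets R_emeasure by (auto simp: f_def intro!: integrable_real_indicator)
  show "Lp_norm p f = (a * b) powr (1 / p)"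
    unfolding Lp_norm_def f_powr
    using R_sub R_emeasure assms by (simp add: measure_def Int_absorb2)
  fix z assume "z \<in> J_inf a b"
  then obtain x y where z: "z = (x, y)" "a \<le> x" "b \<le> y" by (cases z) (auto simp: J_inf_def)
  have inner: "(LINT s:{0..y}|lebesgue. f (t, s)) = b * indicator {0..a} t" for t
  proof -
    have "(LINT s:{0..y}|lebesgue. f (t, s)) = (LINT s|lebesgue. indicator {0..a} t * indicator {0..b} s)"
      unfolding set_lebesgue_integral_def f_def using z
      by (intro Bochner_Integration.integral_cong) (auto simp: indicator_def)
    then show ?thesis using assms by simp
  qed
  have "hardy2 f z = (LINT t:{0..x}|lebesgue. b * indicator {0..a} t)"
    by (simp only: hardy2_def z prod.case inner)
  also have "\<dots> = (LINT t|lebesgue. b * indicator {0..a} t)"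
    unfolding set_lebesgue_integral_def using z
    by (intro Bochner_Integration.integral_cong) (auto simp: indicator_def)
  finally show "hardy2 f z = a * b" using assms by simp
qed

text \<open>The indicator of \<open>[0,a] \<times> [0,b]\<close> has norm \<open>(a b) powr (1/p)\<close> and transform \<open>a b\<close> on
  \<open>J_inf a b\<close>, so boundedness bounds \<open>a b\<close> times the norm of \<open>v\<close> there by
  \<open>c * (a b) powr (1/p)\<close>; now divide, using \<open>1 - 1/p = 1/p'\<close>.\<close>

lemma test_if_hardy2_bounded:
  fixes q v :: "real \<times> real \<Rightarrow> real" and p c a b :: real
  assumes p: "1 < p" and q: "\<And>z. z \<in> quadrant \<Longrightarrow> 0 \<le> q z"
    and bounded: "\<And>f. f \<in> Lp_space p \<Longrightarrow> weighted_var_norm q v (hardy2 f) \<le> ennreal (c * Lp_norm p f)"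
    and ab: "0 < a" "0 < b"
  shows "var_norm q (\<lambda>z. v z * indicator (J_inf a b) z) * ennreal ((a * b) powr (1 / conj_exp p)) \<le> ennreal c"
proof -
  let ?f = "indicator ({0..a} \<times> {0..b}) :: real \<times> real \<Rightarrow> real"
  let ?V = "var_norm q (\<lambda>z. v z * indicator (J_inf a b) z)"
  have "ennreal (a * b) * ?V \<le> var_norm q (\<lambda>z. (a * b) * (v z * indicator (J_inf a b) z))"
    using ab by (intro var_norm_cmult_ge) simp
  also have "\<dots> \<le> weighted_var_norm q v (hardy2 ?f)"
    unfolding weighted_var_norm_def
  proof (rule var_norm_mono)
    fix z
    show "\<bar>a * b * (v z * indicator (J_inf a b) z)\<bar> \<le> \<bar>hardy2 ?f z * v z\<bar>"
      using rectangle_test_function(3)[OF ab, of p z] p by (cases "z \<in> J_inf a b") auto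
  qed (rule q)
  also have "\<dots> \<le> ennreal (c * (a * b) powr (1 / p))"
    using bounded[of ?f] rectangle_test_function(1,2)[OF ab, of p] p by simp
  finally have main: "ennreal (a * b) * ?V \<le> ennreal (c * (a * b) powr (1 / p))" .
  have split: "(a * b) powr (1 / conj_exp p) = (a * b) powr (- (1 / p)) * (a * b)"
  proof -
    have "1 / conj_exp p = - (1 / p) + 1" using p by (simp add: conj_exp_def field_simps)
    then show ?thesis using ab by (simp only: powr_add) simp
  qed
  have "?V * ennreal ((a * b) powr (1 / conj_exp p))
      = ennreal ((a * b) powr (- (1 / p))) * (ennreal (a * b) * ?V)"
    unfolding split using ab by (simp add: ennreal_mult ac_simps)
  also have "\<dots> \<le> ennreal ((a * b) powr (- (1 / p))) * ennreal (c * (a * b) powr (1 / p))"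
    by (intro mult_left_mono main) simp
  also have "\<dots> = ennreal ((a * b) powr (- (1 / p)) * (c * (a * b) powr (1 / p)))"
    by (simp add: ennreal_mult')
  also have "(a * b) powr (- (1 / p)) * (c * (a * b) powr (1 / p)) = c"
    using ab by (simp add: powr_minus field_simps)
  finally show ?thesis .
qed

theorem corollary3p1:
  fixes p :: real and q v :: "real \<times> real \<Rightarrow> real"
  assumes "q \<in> borel_measurable quadrant_measure"
    and "1 < p" and "ereal p \<le> q_minus q" and "q_minus q \<le> q_plus q" and "q_plus q < \<infinity>"
    and "v \<in> borel_measurable quadrant_measure"
    and "AE z in quadrant_measure. 0 < v z"
  shows "hardy2_bounded p q v \<longleftrightarrow>
    (SUP (a, b)\<in>{0<..} \<times> {0<..}.
       var_norm q (\<lambda>z. v z * indicator (J_inf a b) z)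
         * ennreal ((a * b) powr (1 / conj_exp p))) < \<infinity>"
    (is "_ \<longleftrightarrow> ?S < \<infinity>")
proof
  have q: "p \<le> q z" if "z \<in> quadrant" for z
  proof -
    have "q_minus q \<le> ereal (q z)" unfolding q_minus_def using that by (rule INF_lower)
    with assms(3) have "ereal p \<le> ereal (q z)" by (rule order_trans)
    then show ?thesis by simp
  qed
  {
    assume "hardy2_bounded p q v"
    then obtain c where bounded:
        "\<And>f. f \<in> Lp_space p \<Longrightarrow> weighted_var_norm q v (hardy2 f) \<le> ennreal (c * Lp_norm p f)"
      unfolding hardy2_bounded_def by blast
    have q0: "0 \<le> q z" if "z \<in> quadrant" for z using q[OF that] assms(2) by simp
    have "?S \<le> ennreal c"
      by (rule SUP_least) (auto intro!: test_if_hardy2_bounded[OF assms(2) q0 bounded])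
    also have "\<dots> < \<infinity>" by simp
    finally show "?S < \<infinity>" .
  }
  assume "?S < \<infinity>"
  then obtain n :: nat where n: "?S < of_nat n"
    using ennreal_Ex_less_of_nat[of ?S] by auto
  have test: "var_norm q (\<lambda>z. v z * indicator (J_inf a b) z) * ennreal ((a * b) powr (1 / conj_exp p))
      < ennreal (real n)" if "0 < a" "0 < b" for a b
  proof -
    have "var_norm q (\<lambda>z. v z * indicator (J_inf a b) z) * ennreal ((a * b) powr (1 / conj_exp p)) \<le> ?S"
      by (rule SUP_upper2[of "(a, b)"]) (use that in auto)
    also have "\<dots> < ennreal (real n)" using n by (simp add: ennreal_of_nat_eq_real_of_nat)
    finally show ?thesis .
  qed
  have "0 < real n" using n by (cases n) auto
  from hardy2_bounded_if_test[OF assms(2) q this assms(1) assms(6) test]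
  show "hardy2_bounded p q v" .
qed

end
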